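(* Let $$ E_{\text{pos}}^{\text{card}}(b)=\int_0^1x f_b^{\text{card}}(x)\,dx,\quad E_{\text{card}}^{\text{card}}(x)=\int_0^1b\, h_x^{\text{card}}(b)\,db,\quad E_{\text{pos}}^{\text{pos}}(b)=\int_0^1x f_b^{\text{pos}}(x)\,dx,\quad E_{\text{card}}^{\text{pos}}(x)=\int_0^1b\, h_x^{\text{pos}}(b)\,db , $$ for $b,x\in[0,1]$, where $f_b^{\text{card}},h_x^{\text{card}},f_b^{\text{pos}},h_x^{\text{pos}}$ are the limiting densities given in the context. (i) For all $s\in[0,1]$, $$ E_{\text{pos}}^{\text{card}}(s)=E_{\text{card}}^{\text{pos}}(s)=1-\tfrac12e^{-1+s}-(1-s)e^{-1}. $$ The maximum of this function over $s\in[0,1]$ occurs at $s=\log 2\approx 0.693$ with value about $0.519$, and the minimum occurs at $s=0$ with value about $0.448$. (ii) For all $s\in[0,1]$, $$ E_{\text{card}}^{\text{card}}(s)=E_{\text{pos}}^{\text{pos}}(s)=\tfrac12e^{-s}+se^{-1}. $$ The maximum of this function over $s\in[0,1]$ occurs at $s=1$ with value about $0.552$, and the minimum occurs at $s=1-\log 2\approx 0.307$ with value about $0.481$.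
   Context: $S_n$ is the symmetric group of permutations of $[n]=\{1,\dots,n\}$. A permutation $\sigma\in S_n$ is viewed as a deck of cards numbered $1$ to $n$ laid out in a row, where $\sigma_j$ is the number of the card in the $j$-th position from the left and $\sigma_j^{-1}$ is the position of card number $j$. Two shuffles are considered, each consisting of $n$ steps $j=1,\dots,n$ starting from the identity $\text{id}$. In the card cyclic to random transposition shuffle, on step $j$ the card that was originally the $j$-th from the left is transposed with a uniformly random card (possibly itself); in the position cyclic to random transposition shuffle, on step $j$ the card currently in the $j$-th position from the left is transposed with a uniformly random card (possibly itself). Choices at different steps are independent. The resulting distributions on $S_n$ are $p_n^{\text{card}}(\text{id},\cdot)$ and $p_n^{\text{pos}}(\text{id},\cdot)$. For $*\in\{\text{card},\text{pos}\}$ and $b,x\in[0,1]$ with $b\ne x$, and sequences $b_n\to b$, $x_n\to x$ with $b_nn,x_nn\in[n]$ integers, the limiting densities are $f_b^{*}(x)=\lim_{n\to\infty}n\,p_n^{*}(\text{id},\{\sigma^{-1}_{b_nn}=x_nn\})$ and $h_x^{*}(b)=\lim_{n\to\infty}n\,p_n^{*}(\text{id},\{\sigma_{x_nn}=b_nn\})$. Explicitly, $$ f_b^{\text{card}}(x)=h_x^{\text{card}}(b)=\begin{cases} e^{-1+b}+e^{-x}-e^{-1-x+b},& x<b;\\ e^{-1+b}+e^{-x},& x>b,\end{cases} \qquad f_b^{\text{pos}}(x)=h_x^{\text{pos}}(b)=\begin{cases} e^{-1+x}+e^{-b},& x<b;\\ e^{-1+x}+e^{-b}-e^{-1-b+x},&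 x>b.\end{cases} $$ (The value at the single point $x=b$ is irrelevant for the integrals.) Thus $E^{*}_{\text{pos}}(b)$ is the expected limiting rescaled position of a card with number around $bn$, and $E^{*}_{\text{card}}(x)$ is the expected limiting rescaled number of the card in a position around $xn$. "About" and "$\approx$" refer to values rounded to three decimal places; $\log$ is the natural logarithm. *)

theory Defs
  imports "HOL-Probability.Probability" "HOL-Combinatorics.Permutations"
begin

(* A deck of n cards is a permutation \<sigma> of {1..n}, fixed outside that set;
   \<sigma> j is the number of the card in position j, so that interchanging
   the cards numbered c and d turns \<sigma> into transpose c d \<circ> \<sigma>. *)

type_synonym deck = "nat \<Rightarrow> nat"

definition transpose_with_random :: "nat \<Rightarrow> nat \<Rightarrow> deck \<Rightarrow> deck pmf" where
  "transpose_with_random n c \<sigma> = map_pmf (\<lambda>d. Transposition.transpose c d \<circ> \<sigma>) (pmf_of_set {1..n})"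

(* On step j the chosen card is \<sigma>0 j, the card that is j-th in the initial deck,
   in card_shuffle, and \<sigma> j, the card that is j-th in the current deck, in pos_shuffle. *)

definition card_shuffle :: "nat \<Rightarrow> deck \<Rightarrow> deck pmf" where
  "card_shuffle n \<sigma>0 =
     fold (\<lambda>j p. bind_pmf p (\<lambda>\<sigma>. transpose_with_random n (\<sigma>0 j) \<sigma>)) [1..<Suc n] (return_pmf \<sigma>0)"

definition pos_shuffle :: "nat \<Rightarrow> deck \<Rightarrow> deck pmf" where
  "pos_shuffle n \<sigma>0 =
     fold (\<lambda>j p. bind_pmf p (\<lambda>\<sigma>. transpose_with_random n (\<sigma> j) \<sigma>)) [1..<Suc n] (return_pmf \<sigma>0)"

(* L is the limit of n * P n (b_n n) (x_n n) along all sequences b_n \<rightarrow> b and x_n \<rightarrow> x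
   with b_n n and x_n n in {1..n}; the integers b_n n and x_n n are k n and m n. *)

definition is_scaled_limit ::
  "(nat \<Rightarrow> nat \<Rightarrow> nat \<Rightarrow> real) \<Rightarrow> real \<Rightarrow> real \<Rightarrow> real \<Rightarrow> bool" where
  "is_scaled_limit P b x L \<longleftrightarrow>
     (\<forall>k m :: nat \<Rightarrow> nat.
        (\<forall>n\<ge>1. k n \<in> {1..n} \<and> m n \<in> {1..n}) \<longrightarrow>
        (\<lambda>n. real (k n) / real n) \<longlonglongrightarrow> b \<longrightarrow>
        (\<lambda>n. real (m n) / real n) \<longlonglongrightarrow> x \<longrightarrow>
        (\<lambda>n. real n * P n (k n) (m n)) \<longlonglongrightarrow> L)"

(* The densities are meaningful for b, x in [0,1] with b \<noteq> x. On the diagonal b = x the limit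
   need not exist and the value is unspecified; a single point does not affect the integrals. *)

definition position_density :: "(nat \<Rightarrow> deck \<Rightarrow> deck pmf) \<Rightarrow> real \<Rightarrow> real \<Rightarrow> real" where
  "position_density S b x =
     (THE L. is_scaled_limit (\<lambda>n k m. measure_pmf.prob (S n id) {\<sigma>. inv \<sigma> k = m}) b x L)"

definition card_density :: "(nat \<Rightarrow> deck \<Rightarrow> deck pmf) \<Rightarrow> real \<Rightarrow> real \<Rightarrow> real" where
  "card_density S x b =
     (THE L. is_scaled_limit (\<lambda>n k m. measure_pmf.prob (S n id) {\<sigma>. \<sigma> m = k}) b x L)"

definition expected_position :: "(nat \<Rightarrow> deck \<Rightarrow> deck pmf) \<Rightarrow> real \<Rightarrow> real" where
  "expected_position S b = integral {0..1} (\<lambda>x. x * position_density S b x)"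

definition expected_card :: "(nat \<Rightarrow> deck \<Rightarrow> deck pmf) \<Rightarrow> real \<Rightarrow> real" where
  "expected_card S x = integral {0..1} (\<lambda>b. b * card_density S x b)"

definition strict_max_on :: "real set \<Rightarrow> (real \<Rightarrow> real) \<Rightarrow> real \<Rightarrow> bool" where
  "strict_max_on A F s \<longleftrightarrow> s \<in> A \<and> (\<forall>t\<in>A. t \<noteq> s \<longrightarrow> F t < F s)"

definition strict_min_on :: "real set \<Rightarrow> (real \<Rightarrow> real) \<Rightarrow> real \<Rightarrow> bool" where
  "strict_min_on A F s \<longleftrightarrow> s \<in> A \<and> (\<forall>t\<in>A. t \<noteq> s \<longrightarrow> F s < F t)"

definition round3 :: "real \<Rightarrow> real" where
  "round3 y = of_int (round (1000 * y)) / 1000"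

end

theory Submission
  imports Defs "HOL-Real_Asymp.Real_Asymp"
begin

text \<open>
  The marginals of the card shuffle can be computed exactly. Follow the card lying in a fixed
  position \<open>m\<close>: it is a Markov chain on \<open>{1..n}\<close> started at \<open>m\<close>, and on step \<open>j\<close> it jumps to a
  uniform card if it is at \<open>j\<close>, and otherwise jumps to \<open>j\<close> with probability \<open>1/n\<close> and stays put
  with probability \<open>r = 1 - 1/n\<close>. Hence after step \<open>j\<close> the chain is at \<open>j\<close> with probability exactly
  \<open>1/n\<close>, wherever it was before, and the probability \<open>q c\<close> of any other card \<open>c\<close> is replaced by
  \<open>r * q c + q j / n\<close> (\<open>prob_card_steps_Suc\<close>). This recurrence has a closed solution
  (\<open>prob_card_steps\<close>), which after \<open>n\<close> steps gives \<open>n\<close> times the probability of card \<open>k\<close> as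
  \<open>r^(n-k) + r^(m-1) - r^(n-k) * r^(m-1)\<close>, the last term being present only for \<open>m \<le> k\<close>
  (\<open>scaled_prob_card_shuffle\<close>). As \<open>r^(n*t)\<close> tends to \<open>exp (-t)\<close>, the limit densities off the
  diagonal follow.

  The position shuffle needs no separate computation. Interchanging the contents of position \<open>j\<close>
  and of a random position is, for the inverse permutation, interchanging card \<open>j\<close> with a random
  card, so the inverse of a position-shuffled deck is distributed as a card-shuffled deck
  (\<open>map_inv_pos_steps\<close>). All four densities are therefore one function of two variables, and the
  four expectations are the two integrals over its left and its right argument.

  These two integrals are \<open>A s = 1 - (1 + (exp s / 2 - s)) / e\<close> and \<open>B s = 1 - A (1 - s)\<close>, so it is
  enough to find the extrema of \<open>exp s / 2 - s\<close>. It is at least \<open>1 - ln 2\<close>, with equality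
  only at \<open>ln 2\<close>, by the inequality \<open>1 + u \<le> exp u\<close> at \<open>u = s - ln 2\<close>; and, because of convexity and
  \<open>e < 3\<close>, it is largest at \<open>s = 0\<close>.
\<close>

section \<open>The two shuffles as stepwise chains\<close>

primrec card_steps :: "nat \<Rightarrow> nat \<Rightarrow> deck pmf" where
  "card_steps n 0 = return_pmf id"
| "card_steps n (Suc j) = bind_pmf (card_steps n j) (transpose_with_random n (Suc j))"

primrec pos_steps :: "nat \<Rightarrow> nat \<Rightarrow> deck pmf" where
  "pos_steps n 0 = return_pmf id"
| "pos_steps n (Suc j) =
     bind_pmf (pos_steps n j) (\<lambda>\<sigma>. transpose_with_random n (\<sigma> (Suc j)) \<sigma>)"

lemma card_shuffle_eq_steps: "card_shuffle n id = card_steps n n"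
proof -
  have "fold (\<lambda>j p. bind_pmf p (transpose_with_random n (id j))) [1..<Suc i] (return_pmf id)
          = card_steps n i" for i
    by (induction i) (simp_all add: id_def)
  then show ?thesis
    unfolding card_shuffle_def by blast
qed

lemma pos_shuffle_eq_steps: "pos_shuffle n id = pos_steps n n"
proof -
  have "fold (\<lambda>j p. bind_pmf p (\<lambda>\<sigma>. transpose_with_random n (\<sigma> j) \<sigma>)) [1..<Suc i] (return_pmf id)
          = pos_steps n i" for i
    by (induction i) (simp_all add: id_def)
  then show ?thesis
    unfolding pos_shuffle_def by blast
qed

lemma set_transpose_with_random:
  assumes "c \<in> {1..n}" "\<sigma> permutes {1..n}" "\<tau> \<in> set_pmf (transpose_with_random n c \<sigma>)"
  shows "\<tau> permutes {1..n}"
proof -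
  have ne: "{1..n} \<noteq> {}" using assms(1) by blast
  obtain d where "d \<in> {1..n}" "\<tau> = Transposition.transpose c d \<circ> \<sigma>"
    using assms(3) set_pmf_of_set[OF ne] by (auto simp: transpose_with_random_def)
  then show ?thesis
    using permutes_compose[OF assms(2) permutes_swap_id[OF assms(1)]] by simp
qed

lemma card_steps_permutes:
  assumes "j \<le> n" "\<sigma> \<in> set_pmf (card_steps n j)"
  shows "\<sigma> permutes {1..n}"
  using assms
proof (induction j arbitrary: \<sigma>)
  case (Suc j)
  then obtain \<tau> where "\<tau> permutes {1..n}" "\<sigma> \<in> set_pmf (transpose_with_random n (Suc j) \<tau>)"
    by auto
  then show ?case
    using set_transpose_with_random[of "Suc j" n] Suc.prems by simp
qed simp

lemma pos_steps_permutes: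
  assumes "j \<le> n" "\<sigma> \<in> set_pmf (pos_steps n j)"
  shows "\<sigma> permutes {1..n}"
  using assms
proof (induction j arbitrary: \<sigma>)
  case (Suc j)
  then obtain \<tau> where \<tau>: "\<tau> \<in> set_pmf (pos_steps n j)"
      "\<sigma> \<in> set_pmf (transpose_with_random n (\<tau> (Suc j)) \<tau>)"
    by auto
  then have p: "\<tau> permutes {1..n}" using Suc by simp
  then have "\<tau> (Suc j) \<in> {1..n}"
    using Suc.prems(1) permutes_in_image[OF p, of "Suc j"] by simp
  then show ?case
    using set_transpose_with_random p \<tau>(2) by blast
qed simp

section \<open>Duality between the two shuffles\<close>

text \<open>
  The cards \<open>\<sigma> j\<close> and \<open>d\<close> lie in the positions \<open>j\<close> and \<open>inv \<sigma> d\<close> of \<open>\<sigma>\<close>, so on the inverse deck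
  their interchange is that of the cards numbered \<open>j\<close> and \<open>inv \<sigma> d\<close>; and \<open>inv \<sigma> d\<close> is uniform
  because \<open>d\<close> is.
\<close>

lemma inv_transpose_with_random:
  assumes p: "\<sigma> permutes {1..n}" and j: "j \<in> {1..n}"
  shows "map_pmf inv (transpose_with_random n (\<sigma> j) \<sigma>) = transpose_with_random n j (inv \<sigma>)"
proof -
  let ?U = "pmf_of_set {1..n}"
  have ne: "{1..n} \<noteq> {}" using j by blast
  have inv: "inv (Transposition.transpose (\<sigma> j) d \<circ> \<sigma>) = Transposition.transpose j (inv \<sigma> d) \<circ> inv \<sigma>" for d
  proof -
    have b: "bij \<sigma>" using p by (rule permutes_bij)
    have "inv (Transposition.transpose (\<sigma> j) d \<circ> \<sigma>) = inv \<sigma> \<circ> Transposition.transpose (\<sigma> j) d"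
      using b by (simp add: o_inv_distrib)
    also have "\<dots> = Transposition.transpose j (inv \<sigma> d) \<circ> inv \<sigma>"
      using b permutes_inverses[OF p]
      by (auto simp: fun_eq_iff Transposition.transpose_def permutes_inv_eq[OF p])
    finally show ?thesis .
  qed
  have U: "map_pmf (inv \<sigma>) ?U = ?U"
    using permutes_inv[OF p] ne
    by (intro map_pmf_of_set_bij_betw) (auto intro: permutes_imp_bij)
  have "map_pmf inv (transpose_with_random n (\<sigma> j) \<sigma>)
      = map_pmf (\<lambda>d. Transposition.transpose j d \<circ> inv \<sigma>) (map_pmf (inv \<sigma>) ?U)"
    by (simp add: transpose_with_random_def pmf.map_comp o_def[of inv] inv)
       (simp add: o_def)
  then show ?thesis
    unfolding U transpose_with_random_def .
qed

lemma map_inv_pos_steps: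
  assumes "j \<le> n"
  shows "map_pmf inv (pos_steps n j) = card_steps n j"
  using assms
proof (induction j)
  case (Suc j)
  have "map_pmf inv (pos_steps n (Suc j))
      = bind_pmf (pos_steps n j) (\<lambda>\<sigma>. map_pmf inv (transpose_with_random n (\<sigma> (Suc j)) \<sigma>))"
    by (simp add: map_bind_pmf)
  also have "\<dots> = bind_pmf (pos_steps n j) (\<lambda>\<sigma>. transpose_with_random n (Suc j) (inv \<sigma>))"
    using Suc.prems by (intro bind_pmf_cong refl inv_transpose_with_random pos_steps_permutes) auto
  also have "\<dots> = bind_pmf (map_pmf inv (pos_steps n j)) (transpose_with_random n (Suc j))"
    by (simp add: bind_map_pmf)
  finally show ?case
    using Suc by simp
qed (simp add: inv_id)

text \<open>
  The restriction to permutations matters: \<open>inv\<close> is given by a choice operator, and only for a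
  bijection are \<open>inv \<sigma> k = m\<close> and \<open>\<sigma> m = k\<close> the same event.
\<close>

lemma prob_inv_eq:
  assumes "\<And>\<sigma>. \<sigma> \<in> set_pmf p \<Longrightarrow> \<sigma> permutes {1..n}"
  shows "measure_pmf.prob p {\<sigma>. inv \<sigma> k = m} = measure_pmf.prob p {\<sigma>. \<sigma> m = k}"
  using permutes_inv_eq[OF assms]
  by (intro measure_pmf.finite_measure_eq_AE) (auto simp: AE_measure_pmf_iff)

lemma prob_inv_card_shuffle:
  "measure_pmf.prob (card_shuffle n id) {\<sigma>. inv \<sigma> k = m}
     = measure_pmf.prob (card_shuffle n id) {\<sigma>. \<sigma> m = k}"
  unfolding card_shuffle_eq_steps by (rule prob_inv_eq[OF card_steps_permutes[OF order_refl]])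

lemma prob_inv_pos_shuffle:
  "measure_pmf.prob (pos_shuffle n id) {\<sigma>. inv \<sigma> k = m}
     = measure_pmf.prob (card_shuffle n id) {\<sigma>. \<sigma> k = m}"
  unfolding card_shuffle_eq_steps pos_shuffle_eq_steps map_inv_pos_steps[OF order_refl, symmetric]
  by (simp add: vimage_def)

lemma prob_pos_shuffle:
  "measure_pmf.prob (pos_shuffle n id) {\<sigma>. \<sigma> m = k}
     = measure_pmf.prob (card_shuffle n id) {\<sigma>. \<sigma> k = m}"
  unfolding prob_inv_pos_shuffle[symmetric] unfolding pos_shuffle_eq_steps
  by (rule prob_inv_eq[OF pos_steps_permutes[OF order_refl], symmetric])

section \<open>The card in a fixed position as a Markov chain\<close>

lemma prob_transpose_with_random:
  assumes "j \<in> {1..n}" "\<sigma> m \<in> {1..n}" "c \<in> {1..n}"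
  shows "measure_pmf.prob (transpose_with_random n j \<sigma>) {\<tau>. \<tau> m = c} =
           (if \<sigma> m = j \<or> c = j then 1 / real n else if \<sigma> m = c then 1 - 1 / real n else 0)"
proof -
  have ne: "{1..n} \<noteq> {}" using assms(1) by blast
  have "measure_pmf.prob (transpose_with_random n j \<sigma>) {\<tau>. \<tau> m = c}
      = card ({1..n} \<inter> {d. Transposition.transpose j d (\<sigma> m) = c}) / n"
    using measure_pmf_of_set[OF ne finite_atLeastAtMost]
    by (simp add: transpose_with_random_def vimage_def)
  also have "{1..n} \<inter> {d. Transposition.transpose j d (\<sigma> m) = c} =
      (if \<sigma> m = j then {c} else if c = j then {\<sigma> m} else if \<sigma> m = c then {1..n} - {c} else {})"
    using assms by (auto simp: Transposition.transpose_def)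
  finally show ?thesis
    using assms by (auto simp: of_nat_diff field_simps)
qed

text \<open>
  The first case does not involve the previous distribution: from every state of the chain the
  probability of moving to \<open>Suc j\<close> on step \<open>Suc j\<close> is the same \<open>1 / n\<close>.
\<close>

lemma prob_card_steps_Suc:
  assumes m: "m \<in> {1..n}" and c: "c \<in> {1..n}" and j: "Suc j \<le> n"
  shows "measure_pmf.prob (card_steps n (Suc j)) {\<sigma>. \<sigma> m = c} =
    (if c = Suc j then 1 / real n
     else (1 - 1 / real n) * measure_pmf.prob (card_steps n j) {\<sigma>. \<sigma> m = c}
            + measure_pmf.prob (card_steps n j) {\<sigma>. \<sigma> m = Suc j} / n)"
proof -
  let ?p = "card_steps n j"
  have [simp]: "integrable ?p (indicator A :: deck \<Rightarrow> real)" for A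
    by (intro measure_pmf.integrable_const_bound[where B = 1]) auto
  have "measure_pmf.prob (card_steps n (Suc j)) {\<sigma>. \<sigma> m = c}
      = (\<integral>\<sigma>. measure_pmf.prob (transpose_with_random n (Suc j) \<sigma>) {\<tau>. \<tau> m = c} \<partial>?p)"
  proof -
    have "measure_pmf.prob q {\<sigma>. \<sigma> m = c} = pmf (map_pmf (\<lambda>\<sigma>. \<sigma> m) q) c" for q :: "deck pmf"
      by (simp add: pmf_map vimage_def)
    then show ?thesis
      by (simp add: map_bind_pmf pmf_bind)
  qed
  also have "\<dots> = (\<integral>\<sigma>. (if c = Suc j then 1 / real n else (1 - 1 / real n) * indicator {\<sigma>. \<sigma> m = c} \<sigma>
                     + indicator {\<sigma>. \<sigma> m = Suc j} \<sigma> / real n) \<partial>?p)"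
  proof (intro integral_cong_AE)
    show "AE \<sigma> in ?p. measure_pmf.prob (transpose_with_random n (Suc j) \<sigma>) {\<tau>. \<tau> m = c} =
         (if c = Suc j then 1 / real n else (1 - 1 / real n) * indicator {\<sigma>. \<sigma> m = c} \<sigma>
                     + indicator {\<sigma>. \<sigma> m = Suc j} \<sigma> / real n)"
      unfolding AE_measure_pmf_iff
    proof
      fix \<sigma> assume "\<sigma> \<in> set_pmf ?p"
      then have "\<sigma> permutes {1..n}" using card_steps_permutes[of j] j by simp
      then have "\<sigma> m \<in> {1..n}" using permutes_in_image m by metis
      then show "measure_pmf.prob (transpose_with_random n (Suc j) \<sigma>) {\<tau>. \<tau> m = c} =
         (if c = Suc j then 1 / real n else (1 - 1 / real n) * indicator {\<sigma>. \<sigma> m = c} \<sigma>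
                     + indicator {\<sigma>. \<sigma> m = Suc j} \<sigma> / real n)"
        using c j by (subst prob_transpose_with_random) (auto simp: indicator_def)
    qed
  qed simp_all
  also have "\<dots> = (if c = Suc j then 1 / real n
     else (1 - 1 / real n) * measure_pmf.prob ?p {\<sigma>. \<sigma> m = c}
            + measure_pmf.prob ?p {\<sigma>. \<sigma> m = Suc j} / n)"
    by simp
  finally show ?thesis .
qed

text \<open>
  The closed solution of the recurrence. Before step \<open>m\<close> the chain can only have moved to a card
  already treated, so an untreated card other than \<open>m\<close> has probability zero. Step \<open>m\<close> spreads the
  remaining mass \<open>r ^ (m - 1)\<close> evenly, and from then on every untreated card keeps the probability
  \<open>a = r ^ (m - 1) / n\<close>, since \<open>r * a + a / n = a\<close>. A card \<open>c\<close> has probability \<open>1 / n\<close> right after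
  its own step; each later step multiplies this by \<open>r\<close> and, from step \<open>m\<close> on, adds \<open>1 / n\<close> times the
  probability of the card being treated.
\<close>

lemma prob_card_steps:
  assumes m: "m \<in> {1..n}" and c: "c \<in> {1..n}" and "j \<le> n"
  defines "r \<equiv> 1 - 1 / real n"
  shows "measure_pmf.prob (card_steps n j) {\<sigma>. \<sigma> m = c} =
    (if j < m then if c \<le> j then r ^ (j - c) / n else if c = m then r ^ j else 0
     else if c \<le> j
       then (r ^ (j - c) + r ^ (m - 1) - (if m \<le> c then r ^ (j - c + (m - 1)) else 0)) / n
       else r ^ (m - 1) / n)"
  using \<open>j \<le> n\<close> c
proof (induction j arbitrary: c)
  case 0
  then show ?case using m by (simp add: indicator_def)
next
  case (Suc j)
  have r: "1 / real n = 1 - r" "x / real n = x * (1 - r)" for x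
    by (simp_all add: r_def)
  have IH: "measure_pmf.prob (card_steps n j) {\<sigma>. \<sigma> m = c} =
      (if j < m then if c \<le> j then r ^ (j - c) / n else if c = m then r ^ j else 0
       else if c \<le> j
         then (r ^ (j - c) + r ^ (m - 1) - (if m \<le> c then r ^ (j - c + (m - 1)) else 0)) / n
         else r ^ (m - 1) / n)" if "c \<in> {1..n}" for c
    using Suc that by simp
  have sj: "Suc j \<in> {1..n}" using Suc by simp
  show ?case
  proof (cases "c = Suc j")
    case True
    then show ?thesis
      using prob_card_steps_Suc[OF m \<open>c \<in> {1..n}\<close>] Suc.prems by auto
  next
    case False
    then have step: "measure_pmf.prob (card_steps n (Suc j)) {\<sigma>. \<sigma> m = c} =
        r * measure_pmf.prob (card_steps n j) {\<sigma>. \<sigma> m = c}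
            + measure_pmf.prob (card_steps n j) {\<sigma>. \<sigma> m = Suc j} / n"
      using prob_card_steps_Suc[OF m \<open>c \<in> {1..n}\<close>] Suc.prems by (simp add: r_def)
    consider "Suc j < m" | "Suc j = m" | "m \<le> j" by linarith
    then show ?thesis
    proof cases
      case 1
      then show ?thesis
        unfolding step IH[OF sj] IH[OF \<open>c \<in> {1..n}\<close>] using False by (simp add: Suc_diff_le)
    next
      case 2
      then show ?thesis
        unfolding step IH[OF sj] IH[OF \<open>c \<in> {1..n}\<close>] using False
        by (auto simp: Suc_diff_le add_divide_distrib)
    next
      case 3
      then show ?thesis
        unfolding step IH[OF sj] IH[OF \<open>c \<in> {1..n}\<close>] using False
        by (auto simp: Suc_diff_le r algebra_simps)
    qed
  qed
qed

lemma scaled_prob_card_shuffle: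
  assumes "m \<in> {1..n}" "k \<in> {1..n}"
  defines "r \<equiv> 1 - 1 / real n"
  shows "n * measure_pmf.prob (card_shuffle n id) {\<sigma>. \<sigma> m = k} =
    r ^ (n - k) + r ^ (m - 1) - (if m \<le> k then r ^ (n - k) * r ^ (m - 1) else 0)"
  using assms(1,2)
  unfolding card_shuffle_eq_steps prob_card_steps[OF assms(1,2) order_refl] r_def power_add
  by simp

section \<open>The limit densities\<close>

text \<open>
  \<open>limit_density x b\<close> is the limit density at \<open>b\<close> of the rescaled final card in the position \<open>x\<close>
  under the card shuffle; the product is the limit of the term present only for \<open>m \<le> k\<close>.
\<close>

definition limit_density :: "real \<Rightarrow> real \<Rightarrow> real" where
  "limit_density x b = exp (- x) + exp (b - 1) - (if x < b then exp (b - 1) * exp (- x) else 0)"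

lemma tendsto_one_minus_inverse_power:
  assumes "(\<lambda>n. real (e n) / real n) \<longlonglongrightarrow> c"
  shows "(\<lambda>n. (1 - 1 / real n) ^ e n) \<longlonglongrightarrow> exp (- c)"
proof (rule Lim_transform_eventually)
  have "(\<lambda>n. real n * ln (1 - 1 / real n)) \<longlonglongrightarrow> -1"
    by real_asymp
  from tendsto_exp[OF tendsto_mult[OF assms this]]
  show "(\<lambda>n. exp (real (e n) / real n * (real n * ln (1 - 1 / real n)))) \<longlonglongrightarrow> exp (- c)"
    by simp
  show "\<forall>\<^sub>F n in sequentially.
      exp (real (e n) / real n * (real n * ln (1 - 1 / real n))) = (1 - 1 / real n) ^ e n"
    using eventually_ge_at_top[of "2::nat"]
  proof eventually_elim
    case (elim n)
    then have "1 - 1 / real n > 0" by simp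
    with elim show ?case by (simp add: exp_of_nat_mult)
  qed
qed

lemma card_shuffle_scaled_limit:
  assumes "b \<noteq> x"
  shows "is_scaled_limit (\<lambda>n k m. measure_pmf.prob (card_shuffle n id) {\<sigma>. \<sigma> m = k}) b x
           (limit_density x b)"
  unfolding is_scaled_limit_def
proof (intro allI impI)
  fix k m :: "nat \<Rightarrow> nat"
  assume km: "\<forall>n\<ge>1. k n \<in> {1..n} \<and> m n \<in> {1..n}"
    and kb: "(\<lambda>n. real (k n) / real n) \<longlonglongrightarrow> b" and mx: "(\<lambda>n. real (m n) / real n) \<longlonglongrightarrow> x"
  let ?r = "\<lambda>n. 1 - 1 / real n"
  have pos: "\<forall>\<^sub>F n in sequentially. 1 \<le> n" by (rule eventually_ge_at_top)
  have K: "(\<lambda>n. ?r n ^ (n - k n)) \<longlonglongrightarrow> exp (- (1 - b))"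
  proof (rule tendsto_one_minus_inverse_power, rule Lim_transform_eventually)
    show "(\<lambda>n. 1 - real (k n) / real n) \<longlonglongrightarrow> 1 - b" by (intro tendsto_intros kb)
    show "\<forall>\<^sub>F n in sequentially. 1 - real (k n) / real n = real (n - k n) / real n"
      using pos by eventually_elim (use km in \<open>auto simp: of_nat_diff diff_divide_distrib\<close>)
  qed
  have M: "(\<lambda>n. ?r n ^ (m n - 1)) \<longlonglongrightarrow> exp (- x)"
  proof (rule tendsto_one_minus_inverse_power, rule Lim_transform_eventually)
    have "(\<lambda>n. real (m n) / real n - 1 / real n) \<longlonglongrightarrow> x - 0"
      by (intro tendsto_intros mx lim_1_over_n)
    then show "(\<lambda>n. real (m n) / real n - 1 / real n) \<longlonglongrightarrow> x" by simp
    show "\<forall>\<^sub>F n in sequentially. real (m n) / real n - 1 / real n = real (m n - 1) / real n"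
      using pos by eventually_elim (use km in \<open>auto simp: of_nat_diff diff_divide_distrib\<close>)
  qed
  have less: "\<forall>\<^sub>F n in sequentially. f n < g n"
    if "f \<longlonglongrightarrow> u" "g \<longlonglongrightarrow> v" "u < v" for f g :: "nat \<Rightarrow> real" and u v
    using order_tendstoD(1)[OF tendsto_diff[OF that(2,1)], of 0] that(3) by simp
  \<comment> \<open>Off the diagonal the order of \<open>m n\<close> and \<open>k n\<close> is eventually constant, so the case
    distinction in the exact formula disappears in the limit.\<close>
  have I: "\<forall>\<^sub>F n in sequentially. (m n \<le> k n) = (x < b)"
  proof (cases "x < b")
    case True
    have "\<forall>\<^sub>F n in sequentially. real (m n) / real n < real (k n) / real n"
      by (rule less[OF mx kb True])
    with pos show ?thesis
      by eventually_elim (use True in \<open>auto simp: divide_less_cancel\<close>)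
  next
    case False
    have "\<forall>\<^sub>F n in sequentially. real (k n) / real n < real (m n) / real n"
      using assms False by (intro less[OF kb mx]) simp
    with pos show ?thesis
      by eventually_elim (use False in \<open>auto simp: divide_less_cancel\<close>)
  qed
  show "(\<lambda>n. real n * measure_pmf.prob (card_shuffle n id) {\<sigma>. \<sigma> (m n) = k n})
      \<longlonglongrightarrow> limit_density x b"
  proof (rule Lim_transform_eventually)
    have "(\<lambda>n. ?r n ^ (n - k n) + ?r n ^ (m n - 1)
        - of_bool (x < b) * (?r n ^ (n - k n) * ?r n ^ (m n - 1)))
      \<longlonglongrightarrow> exp (- (1 - b)) + exp (- x) - of_bool (x < b) * (exp (- (1 - b)) * exp (- x))"
      by (intro tendsto_intros K M)
    then show "(\<lambda>n. ?r n ^ (n - k n) + ?r n ^ (m n - 1)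
        - of_bool (x < b) * (?r n ^ (n - k n) * ?r n ^ (m n - 1))) \<longlonglongrightarrow> limit_density x b"
      by (cases "x < b") (simp_all add: limit_density_def add.commute)
    show "\<forall>\<^sub>F n in sequentially. ?r n ^ (n - k n) + ?r n ^ (m n - 1)
        - of_bool (x < b) * (?r n ^ (n - k n) * ?r n ^ (m n - 1))
        = real n * measure_pmf.prob (card_shuffle n id) {\<sigma>. \<sigma> (m n) = k n}"
      using pos I
    proof eventually_elim
      case (elim n)
      then have "m n \<in> {1..n}" "k n \<in> {1..n}" using km by auto
      from scaled_prob_card_shuffle[OF this] elim show ?case by auto
    qed
  qed
qed

lemma is_scaled_limit_swap:
  "is_scaled_limit (\<lambda>n k m. P n m k) b x L \<longleftrightarrow> is_scaled_limit P x b L"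
  unfolding is_scaled_limit_def by blast

text \<open>
  A scaled limit is defined by a universal statement about sequences, so its uniqueness rests on
  the existence of such sequences for every pair of points of the unit interval.
\<close>

lemma ex_rescaled_tendsto:
  fixes b :: real
  assumes "b \<in> {0..1}"
  obtains k :: "nat \<Rightarrow> nat"
    where "\<forall>n\<ge>1. k n \<in> {1..n}" "(\<lambda>n. real (k n) / real n) \<longlonglongrightarrow> b"
proof
  \<comment> \<open>The maximum with 1 only matters for \<open>b = 0\<close>, where the ceiling is not in \<open>{1..n}\<close>.\<close>
  let ?k = "\<lambda>n. max 1 (nat \<lceil>b * real n\<rceil>)"
  have bn: "0 \<le> b * real n" "b * real n \<le> real n" for n
    using assms by (auto intro: mult_left_le_one_le)
  show "\<forall>n\<ge>1. ?k n \<in> {1..n}"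
    using bn(2) by (auto simp: ceiling_le_iff nat_le_iff)
  have k: "b * real n \<le> real (?k n)" "real (?k n) \<le> b * real n + 1" for n
    using bn[of n] by linarith+
  show "(\<lambda>n. real (?k n) / real n) \<longlonglongrightarrow> b"
  proof (rule tendsto_sandwich)
    show "\<forall>\<^sub>F n in sequentially. b \<le> real (?k n) / real n"
      using eventually_ge_at_top[of 1] by eventually_elim (use k in \<open>simp add: pos_le_divide_eq\<close>)
    show "\<forall>\<^sub>F n in sequentially. real (?k n) / real n \<le> b + 1 / real n"
      using eventually_ge_at_top[of 1] 
      by eventually_elim (use k in \<open>simp add: pos_divide_le_eq distrib_right\<close>)
    show "(\<lambda>n. b + 1 / real n) \<longlonglongrightarrow> b" by real_asymp
  qed simp
qed

lemma the_scaled_limit: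
  assumes b: "b \<in> {0..1}" and x: "x \<in> {0..1}" and L: "is_scaled_limit P b x L"
  shows "(THE L. is_scaled_limit P b x L) = L"
proof (rule the_equality[where P = "is_scaled_limit P b x", OF L])
  fix L' assume L': "is_scaled_limit P b x L'"
  obtain k where k: "\<forall>n\<ge>1. k n \<in> {1..n}" "(\<lambda>n. real (k n) / real n) \<longlonglongrightarrow> b"
    by (rule ex_rescaled_tendsto[OF b])
  obtain m where m: "\<forall>n\<ge>1. m n \<in> {1..n}" "(\<lambda>n. real (m n) / real n) \<longlonglongrightarrow> x"
    by (rule ex_rescaled_tendsto[OF x])
  have "(\<lambda>n. real n * P n (k n) (m n)) \<longlonglongrightarrow> L" "(\<lambda>n. real n * P n (k n) (m n)) \<longlonglongrightarrow> L'"
    using L L' k m unfolding is_scaled_limit_def by blast+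
  then show "L' = L" using LIMSEQ_unique by blast
qed

lemma density_eq_limit_density:
  assumes "b \<in> {0..1}" "x \<in> {0..1}" "b \<noteq> x"
  shows position_density_card_shuffle: "position_density card_shuffle b x = limit_density x b"
    and card_density_card_shuffle: "card_density card_shuffle x b = limit_density x b"
    and position_density_pos_shuffle: "position_density pos_shuffle b x = limit_density b x"
    and card_density_pos_shuffle: "card_density pos_shuffle x b = limit_density b x"
proof -
  let ?P = "\<lambda>n k m. measure_pmf.prob (card_shuffle n id) {\<sigma>. \<sigma> m = k}"
  have direct: "(THE L. is_scaled_limit ?P b x L) = limit_density x b"
    using assms by (intro the_scaled_limit card_shuffle_scaled_limit)
  have swapped: "(THE L. is_scaled_limit (\<lambda>n k m. ?P n m k) b x L) = limit_density b x"
    using assms card_shuffle_scaled_limit[of x b]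
    by (intro the_scaled_limit) (simp_all add: is_scaled_limit_swap[of ?P])
  show "position_density card_shuffle b x = limit_density x b"
       "card_density card_shuffle x b = limit_density x b"
    using direct by (simp_all add: position_density_def card_density_def prob_inv_card_shuffle)
  show "position_density pos_shuffle b x = limit_density b x"
       "card_density pos_shuffle x b = limit_density b x"
    using swapped
    by (simp_all add: position_density_def card_density_def prob_inv_pos_shuffle prob_pos_shuffle)
qed

section \<open>The expectations\<close>

lemma has_integral_id_times_limit_density_left:
  assumes "s \<in> {0..1}"
  shows "((\<lambda>t. t * limit_density t s) has_integral
    1 - 1/2 * exp (-1 + s) - (1 - s) * exp (-1)) {0..1}"
proof -
  let ?F = "\<lambda>t. - (t + 1) * exp (- t) + t\<^sup>2 / 2 * exp (s - 1)"
  let ?G = "\<lambda>t. ?F t + (t + 1) * exp (- t) * exp (s - 1)"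
  have F: "(?F has_real_derivative t * (exp (- t) + exp (s - 1))) (at t within A)" for t A
    by (auto intro!: derivative_eq_intros simp: algebra_simps)
  have G: "(?G has_real_derivative t * (exp (- t) + exp (s - 1) - exp (s - 1) * exp (- t))) (at t within A)" for t A
    by (rule derivative_eq_intros F refl | simp)+ (simp add: algebra_simps)
  have "((\<lambda>t. t * (exp (- t) + exp (s - 1) - exp (s - 1) * exp (- t))) has_integral ?G s - ?G 0) {0..s}"
    using assms G by (intro fundamental_theorem_of_calculus)
      (auto simp: has_real_derivative_iff_has_vector_derivative)
  then have 1: "((\<lambda>t. t * limit_density t s) has_integral ?G s - ?G 0) {0..s}"
    by (rule has_integral_spike_finite[of "{s}", rotated 2]) (auto simp: limit_density_def)
  have "((\<lambda>t. t * (exp (- t) + exp (s - 1))) has_integral ?F 1 - ?F s) {s..1}"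
    using assms F by (intro fundamental_theorem_of_calculus)
      (auto simp: has_real_derivative_iff_has_vector_derivative)
  then have 2: "((\<lambda>t. t * limit_density t s) has_integral ?F 1 - ?F s) {s..1}"
    by (rule has_integral_eq[rotated]) (auto simp: limit_density_def)
  have "(?G s - ?G 0) + (?F 1 - ?F s) = 1 - 1/2 * exp (-1 + s) - (1 - s) * exp (-1)"
    by (simp add: field_simps exp_diff exp_minus)
  then show ?thesis
    using has_integral_combine[OF _ _ 1 2] assms by (metis atLeastAtMost_iff)
qed

lemma has_integral_id_times_limit_density_right:
  assumes "s \<in> {0..1}"
  shows "((\<lambda>t. t * limit_density s t) has_integral 1/2 * exp (-s) + s * exp (-1)) {0..1}"
proof -
  let ?F = "\<lambda>t. t\<^sup>2 / 2 * exp (- s) + (t - 1) * exp (t - 1)"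
  let ?G = "\<lambda>t. ?F t - (t - 1) * exp (t - 1) * exp (- s)"
  have F: "(?F has_real_derivative t * (exp (- s) + exp (t - 1))) (at t within A)" for t A
    by (auto intro!: derivative_eq_intros simp: algebra_simps)
  have G: "(?G has_real_derivative t * (exp (- s) + exp (t - 1) - exp (t - 1) * exp (- s))) (at t within A)" for t A
    by (rule derivative_eq_intros F refl | simp)+ (simp add: algebra_simps)
  have "((\<lambda>t. t * (exp (- s) + exp (t - 1))) has_integral ?F s - ?F 0) {0..s}"
    using assms F by (intro fundamental_theorem_of_calculus)
      (auto simp: has_real_derivative_iff_has_vector_derivative)
  then have 1: "((\<lambda>t. t * limit_density s t) has_integral ?F s - ?F 0) {0..s}"
    by (rule has_integral_eq[rotated]) (auto simp: limit_density_def)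
  have "((\<lambda>t. t * (exp (- s) + exp (t - 1) - exp (t - 1) * exp (- s))) has_integral ?G 1 - ?G s) {s..1}"
    using assms G by (intro fundamental_theorem_of_calculus)
      (auto simp: has_real_derivative_iff_has_vector_derivative)
  then have 2: "((\<lambda>t. t * limit_density s t) has_integral ?G 1 - ?G s) {s..1}"
    by (rule has_integral_spike_finite[of "{s}", rotated 2]) (auto simp: limit_density_def)
  have "(?F s - ?F 0) + (?G 1 - ?G s) = 1/2 * exp (-s) + s * exp (-1)"
    by (simp add: field_simps exp_diff exp_minus)
  then show ?thesis
    using has_integral_combine[OF _ _ 1 2] assms by (metis atLeastAtMost_iff)
qed

text \<open>
  On the diagonal the densities are an unspecified choice, which a single point keeps out of the
  integrals.
\<close>

lemma integral_off_point:
  fixes f g :: "real \<Rightarrow> real"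
  assumes "(g has_integral I) A" "\<And>t. t \<in> A - {s} \<Longrightarrow> f t = g t"
  shows "integral A f = I"
  using has_integral_spike_finite[of "{s}" A f g I] assms by (simp add: integral_unique)

lemma expected_id_times_limit_density_left:
  assumes "s \<in> {0..1}"
  shows expected_position_card_shuffle:
      "expected_position card_shuffle s = 1 - 1/2 * exp (-1 + s) - (1 - s) * exp (-1)"
    and expected_card_pos_shuffle:
      "expected_card pos_shuffle s = 1 - 1/2 * exp (-1 + s) - (1 - s) * exp (-1)"
proof -
  note I = integral_off_point[OF has_integral_id_times_limit_density_left[OF assms], where s = s]
  show "expected_position card_shuffle s = 1 - 1/2 * exp (-1 + s) - (1 - s) * exp (-1)"
    unfolding expected_position_def
    by (rule I) (use assms in \<open>simp add: position_density_card_shuffle\<close>)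
  show "expected_card pos_shuffle s = 1 - 1/2 * exp (-1 + s) - (1 - s) * exp (-1)"
    unfolding expected_card_def
    by (rule I) (use assms in \<open>simp add: card_density_pos_shuffle\<close>)
qed

lemma expected_id_times_limit_density_right:
  assumes "s \<in> {0..1}"
  shows expected_card_card_shuffle:
      "expected_card card_shuffle s = 1/2 * exp (-s) + s * exp (-1)"
    and expected_position_pos_shuffle:
      "expected_position pos_shuffle s = 1/2 * exp (-s) + s * exp (-1)"
proof -
  note I = integral_off_point[OF has_integral_id_times_limit_density_right[OF assms], where s = s]
  show "expected_card card_shuffle s = 1/2 * exp (-s) + s * exp (-1)"
    unfolding expected_card_def
    by (rule I) (use assms in \<open>simp add: card_density_card_shuffle\<close>)
  show "expected_position pos_shuffle s = 1/2 * exp (-s) + s * exp (-1)"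
    unfolding expected_position_def
    by (rule I) (use assms in \<open>simp add: position_density_pos_shuffle\<close>)
qed

section \<open>Extrema and numerical values\<close>

lemma half_exp_minus_self_greater:
  fixes s :: real
  assumes "s \<noteq> ln 2"
  shows "1 - ln 2 < exp s / 2 - s"
  using assms exp_minus_greater[of "ln 2 - s"] by (simp add: exp_diff)

lemma half_exp_minus_self_less:
  fixes s :: real
  assumes "0 < s" "s \<le> 1"
  shows "exp s / 2 - s < 1 / 2"
proof -
  \<comment> \<open>Convexity puts \<open>exp\<close> below its chord over \<open>{0..1}\<close>, whose slope \<open>e - 1\<close> is less than 2.\<close>
  have "exp s \<le> (1 - s) * exp 0 + s * exp (1 :: real)"
    using convex_onD[OF exp_convex, of s 0 1] assms by simp
  also have "\<dots> < (1 - s) + s * 3"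
    using assms e_less_272 by simp
  finally show ?thesis by simp
qed

lemma ln_2_bounds: "ln 2 \<in> {0.6929<..<(0.6932::real)}"
  using ln_approx_bounds[of 2 3] by (simp add: eval_nat_numeral)

lemma exp_neg1_bounds: "exp (- 1) \<in> {0.3678<..<(0.3679::real)}"
proof -
  have "exp 1 \<in> {2.71827<..<(2.7183::real)}"
    using e_approx_32 unfolding abs_le_iff by (simp add: inverse_eq_divide)
  then show ?thesis by (simp add: exp_minus field_simps)
qed

lemma round3_eq:
  assumes "y - 1 / 2000 < of_int z / 1000" "of_int z / 1000 < y + 1 / 2000"
  shows "round3 y = of_int z / 1000"
proof -
  have "\<bar>1000 * y - of_int z\<bar> < 1 / 2"
    using assms by linarith
  then show ?thesis
    unfolding round3_def by (simp add: round_unique')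
qed

lemma strict_extrema_left:
  defines "F \<equiv> \<lambda>s. 1 - 1/2 * exp (-1 + s) - (1 - s) * exp (-1) :: real"
  assumes "\<And>s. s \<in> {0..1} \<Longrightarrow> E s = F s"
  shows "strict_max_on {0..1} E (ln 2)" "strict_min_on {0..1} E 0"
proof -
  have F: "F s = 1 - exp (-1) * (1 + (exp s / 2 - s))" for s
    by (simp add: F_def exp_diff exp_minus field_simps)
  have "F t < F (ln 2)" if "t \<noteq> ln 2" for t
    using half_exp_minus_self_greater[OF that] by (simp add: F)
  then show "strict_max_on {0..1} E (ln 2)"
    using assms(2) ln_2_bounds by (auto simp: strict_max_on_def)
  have "F 0 < F t" if "0 < t" "t \<le> 1" for t
    using half_exp_minus_self_less[OF that] by (simp add: F)
  then show "strict_min_on {0..1} E 0"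
    using assms(2) by (auto simp: strict_min_on_def)
qed

text \<open>
  The expected card under the card shuffle is the reflection of the expected position in the centre
  of the unit square, which exchanges maxima and minima.
\<close>

lemma strict_max_on_reflect:
  assumes "strict_min_on {0..1} E s" "\<And>t. t \<in> {0..1} \<Longrightarrow> G t = 1 - E (1 - t)"
  shows "strict_max_on {0..1} G (1 - s)"
  using assms by (auto simp: strict_max_on_def strict_min_on_def)

lemma strict_min_on_reflect:
  assumes "strict_max_on {0..1} E s" "\<And>t. t \<in> {0..1} \<Longrightarrow> G t = 1 - E (1 - t)"
  shows "strict_min_on {0..1} G (1 - s)"
  using assms by (auto simp: strict_max_on_def strict_min_on_def)

theorem corollary1:
  shows
    "(\<forall>s\<in>{0..1::real}.
        expected_position card_shuffle s = 1 - 1/2 * exp (-1 + s) - (1 - s) * exp (-1) \<and>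
        expected_card pos_shuffle s = 1 - 1/2 * exp (-1 + s) - (1 - s) * exp (-1)) \<and>
     strict_max_on {0..1} (expected_position card_shuffle) (ln 2) \<and>
     round3 (ln 2) = 0.693 \<and>
     round3 (expected_position card_shuffle (ln 2)) = 0.519 \<and>
     strict_min_on {0..1} (expected_position card_shuffle) 0 \<and>
     round3 (expected_position card_shuffle 0) = 0.448 \<and>
     (\<forall>s\<in>{0..1::real}.
        expected_card card_shuffle s = 1/2 * exp (-s) + s * exp (-1) \<and>
        expected_position pos_shuffle s = 1/2 * exp (-s) + s * exp (-1)) \<and>
     strict_max_on {0..1} (expected_card card_shuffle) 1 \<and>
     round3 (expected_card card_shuffle 1) = 0.552 \<and>
     strict_min_on {0..1} (expected_card card_shuffle) (1 - ln 2) \<and>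
     round3 (1 - ln 2) = 0.307 \<and>
     round3 (expected_card card_shuffle (1 - ln 2)) = 0.481"
proof -
  have ln2: "ln 2 \<in> {0..1::real}" using ln_2_bounds by auto
  have reflect: "expected_card card_shuffle t = 1 - expected_position card_shuffle (1 - t)"
    if "t \<in> {0..1}" for t
    using that by (simp add: expected_card_card_shuffle expected_position_card_shuffle)
  note extrema = strict_extrema_left[OF expected_position_card_shuffle]
  have e: "exp (-1 + ln 2) = 2 * exp (-1 :: real)"
    by (simp only: exp_add exp_ln)
  have at_ln2: "expected_position card_shuffle (ln 2) = 1 - exp (-1) * (2 - ln 2)"
    using expected_position_card_shuffle[OF ln2] e by (simp add: algebra_simps)
  have at_0: "expected_position card_shuffle 0 = 1 - 3/2 * exp (-1)"
    by (simp add: expected_position_card_shuffle)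
  have prod: "exp (-1) * (2 - ln 2) \<in> {0.4806<..<(0.4809::real)}"
  proof -
    have "0.3678 * 1.3068 \<le> exp (-1) * (2 - ln 2 :: real)" "exp (-1) * (2 - ln 2) \<le> 0.3679 * (1.3071 :: real)"
      using exp_neg1_bounds ln_2_bounds by (intro mult_mono; simp)+
    then show ?thesis by simp
  qed
  have "round3 (ln 2) = 0.693" "round3 (1 - ln 2) = 0.307"
    using round3_eq[of "ln 2" 693] round3_eq[of "1 - ln 2" 307] ln_2_bounds by simp_all
  moreover have "round3 (expected_position card_shuffle (ln 2)) = 0.519"
      "round3 (expected_card card_shuffle (1 - ln 2)) = 0.481"
    using round3_eq[of "1 - exp (-1) * (2 - ln 2)" 519] round3_eq[of "exp (-1) * (2 - ln 2)" 481]
      prod ln2 by (simp_all add: reflect at_ln2)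
  moreover have "round3 (expected_position card_shuffle 0) = 0.448"
      "round3 (expected_card card_shuffle 1) = 0.552"
    using round3_eq[of "1 - 3/2 * exp (-1)" 448] round3_eq[of "3/2 * exp (-1)" 552] exp_neg1_bounds
    by (simp_all add: reflect at_0)
  moreover have "strict_max_on {0..1} (expected_card card_shuffle) 1"
    using strict_max_on_reflect[OF extrema(2) reflect] by simp
  moreover have "strict_min_on {0..1} (expected_card card_shuffle) (1 - ln 2)"
    by (rule strict_min_on_reflect[OF extrema(1) reflect])
  ultimately show ?thesis
    using extrema expected_position_card_shuffle expected_card_pos_shuffle
      expected_card_card_shuffle expected_position_pos_shuffle by blast
qed

end
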